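(* Let $\gamma\in[0,1]$, $S^k_\gamma:=Gx^k-\gamma Gx^{k-1}$, and let $\widetilde S^k_\gamma$ be generated by the SAGA estimator described in the context with batch size $b$. For $k\ge0$ let $$\Delta_k:=\frac1{nb}\sum_{i=1}^n\mathbb{E}\big[\|G_ix^k-\gamma G_ix^{k-1}-(1-\gamma)\hat G_i^k\|^2\big],$$ and $\Delta_{-1}:=0$. Then $\widetilde S^k_\gamma$ is a stochastic unbiased variance-reduced estimator of $S^k_\gamma$ with this sequence $\{\Delta_k\}$ and the constants $$\rho:=\frac b{2n}\in(0,1],\qquad C:=\frac{2(n-b)(2n+b)+b^2}{nb},\qquad\hat C:=\frac{2(n-b)(2n+b)\gamma^2}{nb};$$ that is, for all $k\ge0$: $\mathbb{E}_k[\widetilde S^k_\gamma-S^k_\gamma]=0$, $\ \mathbb{E}[\|\widetilde S^k_\gamma-S^k_\gamma\|^2]\le\Delta_k$, and $\Delta_k\le(1-\rho)\Delta_{k-1}+C\,U_k+\hat C\,U_{k-1}$, where $U_k:=\frac1n\sum_{i=1}^n\mathbb{E}[\|G_ix^k-G_ix^{k-1}\|^2]$.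
   Context: $G=\frac1n\sum_{i=1}^nG_i$ with $G_i:\mathbb{R}^p\to\mathbb{R}^p$; norms are Euclidean; $x^0$ is deterministic and $x^{-1}=x^{-2}:=x^0$. $\mathbb{E}_k[\cdot]:=\mathbb{E}[\cdot\mid\sigma(x^0,\dots,x^k)]$. SAGA estimator. Put $\hat G_i^0:=G_ix^0$ for all $i$. At each iteration $k\ge0$, a mini-batch $\mathcal{B}_k\subseteq\{1,\dots,n\}$ of fixed size $b$ is drawn uniformly at random, independently of everything generated before; with $G_{\mathcal{B}_k}z:=\frac1b\sum_{i\in\mathcal{B}_k}G_iz$ and $\hat G^k_{\mathcal{B}_k}:=\frac1b\sum_{i\in\mathcal{B}_k}\hat G_i^k$ one sets $$\widetilde S^k_\gamma:=\big[G_{\mathcal{B}_k}x^k-\gamma G_{\mathcal{B}_k}x^{k-1}-(1-\gamma)\hat G^k_{\mathcal{B}_k}\big]+\frac{1-\gamma}n\sum_{i=1}^n\hat G_i^k.$$ Then $x^{k+1}$ is computed from the quantities available so far (including $\widetilde S^k_\gamma$), and the table is updated by $\hat G_i^{k+1}:=G_ix^k$ if $i\in\mathcal{B}_k$ and $\hat G_i^{k+1}:=\hat G_i^k$ otherwise. *)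

theory Defs
  imports "HOL-Probability.Probability"
begin

text \<open>
  The component operators are \<open>G i\<close> for \<open>i \<in> {1..n}\<close>; the iterates are random vectors
  \<open>x k\<close>, \<open>k \<ge> 0\<close>.  The convention $x^{-1} = x^{-2} = x^0$ is built into the extension of the
  sequence to integer indices, since \<open>nat\<close> sends negative integers to \<open>0\<close>.
\<close>

definition iterate :: "(nat \<Rightarrow> 'w \<Rightarrow> 'v) \<Rightarrow> int \<Rightarrow> 'w \<Rightarrow> 'v" where
  "iterate x k = x (nat k)"

definition mean_op :: "nat \<Rightarrow> (nat \<Rightarrow> 'v \<Rightarrow> 'v) \<Rightarrow> 'v \<Rightarrow> 'v::real_vector" where
  "mean_op n G z = (1 / real n) *\<^sub>R (\<Sum>i=1..n. G i z)"

definition S_target ::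
    "nat \<Rightarrow> (nat \<Rightarrow> 'v \<Rightarrow> 'v) \<Rightarrow> real \<Rightarrow> (nat \<Rightarrow> 'w \<Rightarrow> 'v) \<Rightarrow> nat \<Rightarrow> 'w \<Rightarrow> 'v::real_vector" where
  "S_target n G \<gamma> x k \<omega> =
     mean_op n G (iterate x (int k) \<omega>) - \<gamma> *\<^sub>R mean_op n G (iterate x (int k - 1) \<omega>)"

text \<open>\<open>saga_table G x B k i\<close> is the table entry $\hat G_i^k$.\<close>

primrec saga_table ::
    "(nat \<Rightarrow> 'v \<Rightarrow> 'v) \<Rightarrow> (nat \<Rightarrow> 'w \<Rightarrow> 'v) \<Rightarrow> (nat \<Rightarrow> 'w \<Rightarrow> nat set) \<Rightarrow> nat \<Rightarrow> nat \<Rightarrow> 'w \<Rightarrow> 'v" where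
  "saga_table G x B 0 i \<omega> = G i (x 0 \<omega>)"
| "saga_table G x B (Suc k) i \<omega> =
     (if i \<in> B k \<omega> then G i (x k \<omega>) else saga_table G x B k i \<omega>)"

definition saga_estimator ::
    "nat \<Rightarrow> nat \<Rightarrow> (nat \<Rightarrow> 'v \<Rightarrow> 'v) \<Rightarrow> real \<Rightarrow> (nat \<Rightarrow> 'w \<Rightarrow> 'v) \<Rightarrow> (nat \<Rightarrow> 'w \<Rightarrow> nat set)
      \<Rightarrow> nat \<Rightarrow> 'w \<Rightarrow> 'v::real_vector" where
  "saga_estimator n b G \<gamma> x B k \<omega> =
     ((1 / real b) *\<^sub>R (\<Sum>i\<in>B k \<omega>. G i (iterate x (int k) \<omega>))
      - \<gamma> *\<^sub>R ((1 / real b) *\<^sub>R (\<Sum>i\<in>B k \<omega>. G i (iterate x (int k - 1) \<omega>)))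
      - (1 - \<gamma>) *\<^sub>R ((1 / real b) *\<^sub>R (\<Sum>i\<in>B k \<omega>. saga_table G x B k i \<omega>)))
     + ((1 - \<gamma>) / real n) *\<^sub>R (\<Sum>i=1..n. saga_table G x B k i \<omega>)"

definition batches :: "nat \<Rightarrow> nat \<Rightarrow> nat set set" where
  "batches n b = {T. T \<subseteq> {1..n} \<and> card T = b}"

text \<open>
  The \<open>\<sigma>\<close>-algebra \<open>F k\<close> contains everything generated before the mini-batch \<open>B k\<close> is drawn: the
  iterates \<open>x 0, \<dots>, x k\<close>, the values \<open>G i (x j)\<close> for \<open>j \<le> k\<close>, and the mini-batches
  \<open>B 0, \<dots>, B (k - 1)\<close>.  That $x^{k+1}$ is computed from the quantities available so far is the
  requirement that \<open>x (Suc k)\<close> is \<open>F (Suc k)\<close>-measurable; the table and the estimator of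
  step \<open>k\<close> are functions of quantities in \<open>F (Suc k)\<close>.  The update may be any measurable rule,
  and \<open>F\<close> may carry further randomness used by it.

  Measurability and square integrability of the values \<open>G i (x k)\<close> only ensure that the expectations
  in question exist.  The former is automatic if each \<open>G i\<close> is Borel; both are automatic if
  \<open>x (Suc k)\<close> is a deterministic function of \<open>x 0\<close> and \<open>B 0, \<dots>, B k\<close>, with \<open>F k\<close> generated
  by \<open>B 0, \<dots>, B (k - 1)\<close>, since then only finitely many values occur.
\<close>

locale saga_process =
  prob_space M + filtration "space M" F
  for M :: "'w measure" and F :: "nat \<Rightarrow> 'w measure" +
  fixes n b :: nat
    and G :: "nat \<Rightarrow> real ^ 'p \<Rightarrow> real ^ 'p"
    and x0 :: "real ^ 'p"
    and x :: "nat \<Rightarrow> 'w \<Rightarrow> real ^ 'p"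
    and B :: "nat \<Rightarrow> 'w \<Rightarrow> nat set"
  assumes batch_size: "1 \<le> b" "b \<le> n"
    and subalg: "\<And>k. subalgebra M (F k)"
    and x_init: "\<And>\<omega>. \<omega> \<in> space M \<Longrightarrow> x 0 \<omega> = x0"
    and x_adapted: "\<And>k. x k \<in> borel_measurable (F k)"
    and Gx_adapted: "\<And>i k. i \<in> {1..n} \<Longrightarrow> (\<lambda>\<omega>. G i (x k \<omega>)) \<in> borel_measurable (F k)"
    and Gx_square_integrable: "\<And>i k. i \<in> {1..n} \<Longrightarrow> integrable M (\<lambda>\<omega>. (norm (G i (x k \<omega>)))\<^sup>2)"
    and B_adapted: "\<And>k. B k \<in> measurable (F (Suc k)) (count_space (batches n b))"
    and B_uniform:
      "\<And>k. distr M (count_space (batches n b)) (B k) = uniform_count_measure (batches n b)"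
    and B_indep:
      "\<And>k. indep_set (sets (F k)) (sets (vimage_algebra (space M) (B k) (count_space (batches n b))))"

definition sigma_iterates ::
    "'w measure \<Rightarrow> (nat \<Rightarrow> 'w \<Rightarrow> 'v::topological_space) \<Rightarrow> nat \<Rightarrow> 'w measure" where
  "sigma_iterates M x k = sigma (space M) {x j -` A \<inter> space M | j A. j \<le> k \<and> A \<in> sets borel}"

definition U_seq ::
    "'w measure \<Rightarrow> nat \<Rightarrow> (nat \<Rightarrow> 'v \<Rightarrow> 'v) \<Rightarrow> (nat \<Rightarrow> 'w \<Rightarrow> 'v::real_normed_vector) \<Rightarrow> int \<Rightarrow> real" where
  "U_seq M n G x k = (1 / real n) * (\<Sum>i=1..n.
     integral\<^sup>L M (\<lambda>\<omega>. (norm (G i (iterate x k \<omega>) - G i (iterate x (k - 1) \<omega>)))\<^sup>2))"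

definition saga_Delta ::
    "'w measure \<Rightarrow> nat \<Rightarrow> nat \<Rightarrow> (nat \<Rightarrow> 'v \<Rightarrow> 'v) \<Rightarrow> real \<Rightarrow> (nat \<Rightarrow> 'w \<Rightarrow> 'v::real_normed_vector)
      \<Rightarrow> (nat \<Rightarrow> 'w \<Rightarrow> nat set) \<Rightarrow> int \<Rightarrow> real" where
  "saga_Delta M n b G \<gamma> x B k = (if k < 0 then 0 else
     (1 / (real n * real b)) * (\<Sum>i=1..n.
       integral\<^sup>L M (\<lambda>\<omega>. (norm (G i (iterate x k \<omega>) - \<gamma> *\<^sub>R G i (iterate x (k - 1) \<omega>)
         - (1 - \<gamma>) *\<^sub>R saga_table G x B (nat k) i \<omega>))\<^sup>2)))"

text \<open>
  The conditional expectation of the random vector is taken componentwise, as the library has it for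
  real random variables only.  Integrability is asked for explicitly because the Bochner integral of
  a non-integrable function is \<open>0\<close>.
\<close>

definition unbiased_vr_estimator ::
    "'w measure \<Rightarrow> nat \<Rightarrow> (nat \<Rightarrow> real ^ 'p \<Rightarrow> real ^ 'p) \<Rightarrow> (nat \<Rightarrow> 'w \<Rightarrow> real ^ 'p)
      \<Rightarrow> (nat \<Rightarrow> 'w \<Rightarrow> real ^ 'p) \<Rightarrow> (nat \<Rightarrow> 'w \<Rightarrow> real ^ 'p)
      \<Rightarrow> (int \<Rightarrow> real) \<Rightarrow> real \<Rightarrow> real \<Rightarrow> real \<Rightarrow> bool" where
  "unbiased_vr_estimator M n G x S St \<Delta> \<rho> C C' \<longleftrightarrow>
     \<rho> \<in> {0<..1} \<and>
     (\<forall>k.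
       (\<forall>j. AE \<omega> in M.
          real_cond_exp M (sigma_iterates M x k) (\<lambda>\<omega>. (St k \<omega> - S k \<omega>) $ j) \<omega> = 0) \<and>
       integrable M (\<lambda>\<omega>. (norm (St k \<omega> - S k \<omega>))\<^sup>2) \<and>
       integral\<^sup>L M (\<lambda>\<omega>. (norm (St k \<omega> - S k \<omega>))\<^sup>2) \<le> \<Delta> (int k) \<and>
       \<Delta> (int k) \<le> (1 - \<rho>) * \<Delta> (int k - 1)
         + C * U_seq M n G x (int k) + C' * U_seq M n G x (int k - 1))"

end

theory Submission
  imports Defs
begin

text \<open>
  Write $Y_i^k = G_i x^k - \gamma G_i x^{k-1} - (1-\gamma)\hat G_i^k$ (\<open>saga_residual\<close>) and
  $D_i^k = G_i x^k - G_i x^{k-1}$ (\<open>saga_increment\<close>).  The error of the estimator is the deviation of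
  a batch mean from the full mean,
  $$\widetilde S^k_\gamma - S^k_\gamma = \frac1b\sum_{i\in B_k} Y_i^k - \frac1n\sum_{i=1}^n Y_i^k,$$
  and the $Y_i^k$ are determined before \<open>B k\<close> is drawn.  By independence, integrating over \<open>B k\<close>
  amounts to averaging over all batches with the $Y_i^k$ held fixed (\<open>integral_random_batch\<close>), so the
  first two claims are facts about sampling without replacement: the deviations average to zero
  (\<open>sum_batch_error\<close>), and their mean square is at most $\frac1{nb}\sum_i\|Y_i^k\|^2$
  (\<open>batch_mean_deviation\<close>), whose expectation is $\Delta_k$.

  For the recursion, the table update gives (\<open>saga_residual_Suc\<close>)
  $$Y_i^{k+1} = D_i^{k+1} \mbox{ if } i\in B_k, \qquad
    Y_i^{k+1} = Y_i^k + D_i^{k+1} - \gamma D_i^k \mbox{ otherwise.}$$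
  The delicate point is that $x^{k+1}$ is computed from \<open>B k\<close>, so $D_i^{k+1}$ need not be independent
  of the event $i\in B_k$: it may be concentrated on one of the two cases, and no factor $b/n$ or $1-b/n$ can
  be attached to it.  Only $Y_i^k$ and $D_i^k$ gain the factor $1-b/n$ (\<open>integral_unrefreshed\<close>).  In
  the second case the square is therefore split by the Cauchy--Schwarz inequality with three weights
  $$\|u+v+w\|^2\le\alpha\|u\|^2+\beta\|v\|^2+\delta\|w\|^2,\qquad
    \frac1\alpha+\frac1\beta+\frac1\delta\le1,$$
  where $\beta = bC$ must cover $D_i^{k+1}$ in both cases alike, and $\alpha$, $\delta$ are
  the values for which $(1-\frac bn)\alpha = 1-\rho$ and $(1-\frac bn)\delta\gamma^2 = b\hat C$.  That
  these weights are admissible whenever $b<n$ is \<open>young_weights_sum_le_1\<close>; for $b=n$ the second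
  case does not occur.
\<close>

section \<open>Sampling batches without replacement\<close>

lemma finite_batches: "finite (batches n b)"
  unfolding batches_def by (rule finite_subset[of _ "Pow {1..n}"]) auto

lemma card_batches: "card (batches n b) = n choose b"
  unfolding batches_def using n_subsets[of "{1..n}" b] by simp

lemma batchesD:
  assumes "T \<in> batches n b"
  shows "T \<subseteq> {1..n}" "card T = b"
  using assms by (auto simp: batches_def)

lemma card_batches_containing:
  assumes "A \<subseteq> {1..n}" "card A \<le> b"
  shows "card {T \<in> batches n b. A \<subseteq> T} = (n - card A) choose (b - card A)"
proof -
  have fA: "finite A" using assms(1) finite_subset by blast
  have "bij_betw (\<lambda>T. T - A) {T \<in> batches n b. A \<subseteq> T}
          {R. R \<subseteq> {1..n} - A \<and> card R = b - card A}"
  proof (rule bij_betw_byWitness[where f' = "\<lambda>R. R \<union> A"])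
    show "(\<lambda>T. T - A) ` {T \<in> batches n b. A \<subseteq> T}
            \<subseteq> {R. R \<subseteq> {1..n} - A \<and> card R = b - card A}"
      using fA by (auto simp: batches_def card_Diff_subset)
    show "(\<lambda>R. R \<union> A) ` {R. R \<subseteq> {1..n} - A \<and> card R = b - card A}
            \<subseteq> {T \<in> batches n b. A \<subseteq> T}"
    proof safe
      fix R assume R: "R \<subseteq> {1..n} - A" "card R = b - card A"
      then have "card (R \<union> A) = card R + card A"
        using fA by (intro card_Un_disjoint) (auto intro: finite_subset)
      then show "R \<union> A \<in> batches n b"
        using R assms by (auto simp: batches_def)
    qed
  qed auto
  then have "card {T \<in> batches n b. A \<subseteq> T} = card ({1..n} - A) choose (b - card A)"
    using n_subsets[of "{1..n} - A" "b - card A"] by (simp add: bij_betw_same_card)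
  then show ?thesis
    using fA assms(1) by (simp add: card_Diff_subset)
qed

lemma card_batches_containing_point:
  assumes "1 \<le> b" "b \<le> n" "i \<in> {1..n}"
  shows "real (card {T \<in> batches n b. i \<in> T}) = real (card (batches n b)) * (real b / real n)"
proof -
  have "card {T \<in> batches n b. i \<in> T} = (n - 1) choose (b - 1)"
    using card_batches_containing[of "{i}" n b] assms by simp
  moreover have "real b * real (n choose b) = real n * real ((n - 1) choose (b - 1))"
    using times_binomial_minus1_eq[of b n] assms(1) by (metis of_nat_mult less_le_trans zero_less_one)
  ultimately show ?thesis
    using assms by (simp add: card_batches field_simps)
qed

lemma card_batches_containing_pair:
  assumes "1 \<le> b" "b \<le> n" "i \<in> {1..n}" "j \<in> {1..n}" "i \<noteq> j"
  shows "real (card {T \<in> batches n b. i \<in> T \<and> j \<in> T})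
    = real (card (batches n b)) * (real b / real n * ((real b - 1) / (real n - 1)))"
proof (cases "b = 1")
  case True
  then have "{T \<in> batches n b. i \<in> T \<and> j \<in> T} = {}"
    using assms(5) by (auto simp: batches_def card_1_singleton_iff)
  then have "card {T \<in> batches n b. i \<in> T \<and> j \<in> T} = 0" by (simp only: card.empty)
  then show ?thesis using True by simp
next
  case False
  then have b: "2 \<le> b" "2 \<le> n" using assms by auto
  have "card {T \<in> batches n b. i \<in> T \<and> j \<in> T} = (n - 2) choose (b - 2)"
    using card_batches_containing[of "{i, j}" n b] assms b by (simp add: numeral_2_eq_2)
  moreover have "real b * real (n choose b) = real n * real ((n - 1) choose (b - 1))"
    using times_binomial_minus1_eq[of b n] assms(1) by (metis of_nat_mult less_le_trans zero_less_one)
  moreover have "(real b - 1) * real ((n - 1) choose (b - 1))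
      = (real n - 1) * real ((n - 2) choose (b - 2))"
  proof -
    have "(b - 1) * ((n - 1) choose (b - 1)) = (n - 1) * ((n - 2) choose (b - 2))"
      using times_binomial_minus1_eq[of "b - 1" "n - 1"] b by (simp add: numeral_2_eq_2)
    then have "real (b - 1) * real ((n - 1) choose (b - 1))
        = real (n - 1) * real ((n - 2) choose (b - 2))"
      by (metis of_nat_mult)
    then show ?thesis using b by (simp add: of_nat_diff)
  qed
  ultimately have "real ((n - 1) choose (b - 1)) = real b / real n * real (n choose b)"
    and "real (card {T \<in> batches n b. i \<in> T \<and> j \<in> T})
      = (real b - 1) / (real n - 1) * real ((n - 1) choose (b - 1))"
    using b by (simp_all add: field_simps)
  then show ?thesis by (simp add: card_batches mult_ac)
qed

text \<open>
  Double counting: each index lies in the same number of batches.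
\<close>

lemma sum_over_batches:
  fixes y :: "nat \<Rightarrow> 'a::real_vector"
  assumes "1 \<le> b" "b \<le> n"
  shows "(\<Sum>T\<in>batches n b. \<Sum>i\<in>T. y i)
    = (real (card (batches n b)) * (real b / real n)) *\<^sub>R (\<Sum>i=1..n. y i)"
proof -
  have "(\<Sum>T\<in>batches n b. \<Sum>i\<in>T. y i) = (\<Sum>T\<in>batches n b. \<Sum>i\<in>{i\<in>{1..n}. i \<in> T}. y i)"
    by (intro sum.cong refl) (auto simp: batches_def)
  also have "\<dots> = (\<Sum>i=1..n. \<Sum>T\<in>{T \<in> batches n b. i \<in> T}. y i)"
    by (rule sum.swap_restrict) (auto simp: finite_batches)
  also have "\<dots> = (\<Sum>i=1..n. real (card {T \<in> batches n b. i \<in> T}) *\<^sub>R y i)"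
    by (simp add: scaleR_conv_of_real sum_constant_scaleR)
  also have "\<dots> = (\<Sum>i=1..n. (real (card (batches n b)) * (real b / real n)) *\<^sub>R y i)"
    using assms by (intro sum.cong refl) (simp only: card_batches_containing_point)
  finally show ?thesis by (simp only: scaleR_sum_right)
qed

text \<open>
  Expanding the square leaves $y_i\cdot y_j$ weighted by the probability that a batch contains both
  indices, which is \<open>p\<close> on the diagonal and \<open>q\<close> off it.  For $n = 1$ there are no off-diagonal
  terms, and \<open>q\<close> is \<open>0\<close> by the convention for division by zero.
\<close>

lemma sum_over_batches_norm_sq:
  fixes y :: "nat \<Rightarrow> 'a::real_inner"
  assumes "1 \<le> b" "b \<le> n"
  defines "p \<equiv> real b / real n" and "q \<equiv> real b / real n * ((real b - 1) / (real n - 1))"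
  shows "(\<Sum>T\<in>batches n b. (norm (\<Sum>i\<in>T. y i))\<^sup>2)
    = real (card (batches n b)) * ((p - q) * (\<Sum>i=1..n. (norm (y i))\<^sup>2) + q * (norm (\<Sum>i=1..n. y i))\<^sup>2)"
proof -
  let ?N = "real (card (batches n b))"
  have norm_sum: "(norm (\<Sum>i\<in>A. y i))\<^sup>2 = (\<Sum>i\<in>A. \<Sum>j\<in>A. y i \<bullet> y j)" for A
    unfolding power2_norm_eq_inner inner_sum_left unfolding inner_sum_right ..
  have "(\<Sum>T\<in>batches n b. (norm (\<Sum>i\<in>T. y i))\<^sup>2)
      = (\<Sum>T\<in>batches n b. \<Sum>z\<in>{z \<in> {1..n} \<times> {1..n}. fst z \<in> T \<and> snd z \<in> T}. y (fst z) \<bullet> y (snd z))"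
  proof (rule sum.cong[OF refl])
    fix T assume T: "T \<in> batches n b"
    have "{z \<in> {1..n} \<times> {1..n}. fst z \<in> T \<and> snd z \<in> T} = T \<times> T"
      using batchesD(1)[OF T] by auto
    then show "(norm (\<Sum>i\<in>T. y i))\<^sup>2
        = (\<Sum>z\<in>{z \<in> {1..n} \<times> {1..n}. fst z \<in> T \<and> snd z \<in> T}. y (fst z) \<bullet> y (snd z))"
      by (simp add: norm_sum sum.cartesian_product case_prod_beta)
  qed
  also have "\<dots> = (\<Sum>z\<in>{1..n} \<times> {1..n}. \<Sum>T\<in>{T \<in> batches n b. fst z \<in> T \<and> snd z \<in> T}.
      y (fst z) \<bullet> y (snd z))"
    by (rule sum.swap_restrict) (auto simp: finite_batches)
  also have "\<dots> = (\<Sum>i=1..n. \<Sum>j=1..n. real (card {T \<in> batches n b. i \<in> T \<and> j \<in> T}) * (y i \<bullet> y j))"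
    by (simp add: sum.cartesian_product case_prod_beta)
  also have "\<dots> = (\<Sum>i=1..n. \<Sum>j=1..n. ?N * (q * (y i \<bullet> y j)
      + (if i = j then (p - q) * (y i \<bullet> y i) else 0)))"
  proof (intro sum.cong refl)
    fix i j assume ij: "i \<in> {1..n}" "j \<in> {1..n}"
    show "real (card {T \<in> batches n b. i \<in> T \<and> j \<in> T}) * (y i \<bullet> y j)
      = ?N * (q * (y i \<bullet> y j) + (if i = j then (p - q) * (y i \<bullet> y i) else 0))"
    proof (cases "i = j")
      case True
      then show ?thesis
        using card_batches_containing_point[OF assms(1,2) ij(1)] by (simp add: p_def algebra_simps)
    next
      case False
      then show ?thesis
        using card_batches_containing_pair[OF assms(1,2) ij False] unfolding q_def by simp
    qed
  qed
  also have "\<dots> = ?N * (q * (\<Sum>i=1..n. \<Sum>j=1..n. y i \<bullet> y j) + (p - q) * (\<Sum>i=1..n. y i \<bullet> y i))"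
    by (simp add: sum_distrib_left sum.distrib distrib_left del: sum.delta)
       (simp add: sum.delta if_distrib[of "\<lambda>u. _ * u"] cong: if_cong)
  finally show ?thesis
    unfolding norm_sum by (simp add: power2_norm_eq_inner add.commute)
qed

text \<open>
  The mean square of the deviation is
  $\frac{p-q}{b^2}\sum_i\|y_i\|^2 + (\frac q{b^2}-\frac1{n^2})\|\sum_i y_i\|^2$.  Its second coefficient is
  not positive, because drawing without replacement makes two indices negatively correlated
  ($q\le p^2$), and $p/b^2 = 1/(nb)$.
\<close>

lemma batch_mean_deviation:
  fixes y :: "nat \<Rightarrow> 'a::real_inner"
  assumes "1 \<le> b" "b \<le> n"
  shows "(\<Sum>T\<in>batches n b. (norm ((1 / real b) *\<^sub>R (\<Sum>i\<in>T. y i) - (1 / real n) *\<^sub>R (\<Sum>i=1..n. y i)))\<^sup>2)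
    \<le> real (card (batches n b)) * (1 / (real n * real b) * (\<Sum>i=1..n. (norm (y i))\<^sup>2))"
proof -
  define p where "p = real b / real n"
  define q where "q = real b / real n * ((real b - 1) / (real n - 1))"
  define s where "s = (\<Sum>i=1..n. y i)"
  define Q where "Q = (\<Sum>i=1..n. (norm (y i))\<^sup>2)"
  let ?N = "real (card (batches n b))"
  have pos: "0 < real b" "0 < real n" "real b \<le> real n" "1 \<le> real b" using assms by auto
  have q0: "0 \<le> q" unfolding q_def using pos by (intro mult_nonneg_nonneg divide_nonneg_nonneg) auto
  have "(real b - 1) / (real n - 1) \<le> real b / real n"
  proof (cases "n = 1")
    case False
    then have "0 < real n - 1" using assms by simp
    then show ?thesis using pos by (simp add: field_simps)
  qed simp
  then have "q \<le> real b / real n * (real b / real n)"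
    unfolding q_def using pos by (intro mult_left_mono) auto
  then have qle: "q / (real b)\<^sup>2 \<le> 1 / (real n)\<^sup>2"
    using pos by (simp add: field_simps power2_eq_square)
  have Q0: "0 \<le> Q" unfolding Q_def by (intro sum_nonneg) auto
  have square: "(norm ((1 / real b) *\<^sub>R v - (1 / real n) *\<^sub>R s))\<^sup>2
    = (1 / (real b)\<^sup>2) * (norm v)\<^sup>2 - (2 / (real b * real n)) * (v \<bullet> s)
      + (1 / (real n)\<^sup>2) * (norm s)\<^sup>2" for v :: 'a
    unfolding power2_norm_eq_inner inner_diff_left inner_diff_right inner_scaleR_left
      inner_scaleR_right inner_commute[of s v]
    using pos by (simp add: field_simps power2_eq_square)
  have "(\<Sum>T\<in>batches n b. (norm ((1 / real b) *\<^sub>R (\<Sum>i\<in>T. y i) - (1 / real n) *\<^sub>R s))\<^sup>2)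
    = (\<Sum>T\<in>batches n b. (1 / (real b)\<^sup>2) * (norm (\<Sum>i\<in>T. y i))\<^sup>2
        - (2 / (real b * real n)) * ((\<Sum>i\<in>T. y i) \<bullet> s) + (1 / (real n)\<^sup>2) * (norm s)\<^sup>2)"
    unfolding square ..
  also have "\<dots> = (1 / (real b)\<^sup>2) * (\<Sum>T\<in>batches n b. (norm (\<Sum>i\<in>T. y i))\<^sup>2)
      - (2 / (real b * real n)) * ((\<Sum>T\<in>batches n b. \<Sum>i\<in>T. y i) \<bullet> s)
      + ?N * ((1 / (real n)\<^sup>2) * (norm s)\<^sup>2)"
    by (simp add: sum.distrib sum_subtractf sum_distrib_left inner_sum_left)
  also have "\<dots> = (1 / (real b)\<^sup>2) * (?N * ((p - q) * Q + q * (norm s)\<^sup>2))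
      - (2 / (real b * real n)) * (?N * p * (norm s)\<^sup>2) + ?N * ((1 / (real n)\<^sup>2) * (norm s)\<^sup>2)"
    unfolding sum_over_batches_norm_sq[OF assms, of y, folded q_def p_def s_def Q_def]
      sum_over_batches[OF assms, of y, folded p_def s_def]
    by (simp only: inner_scaleR_left power2_norm_eq_inner)
  also have "\<dots> = ?N * ((p - q) / (real b)\<^sup>2 * Q + (q / (real b)\<^sup>2 - 1 / (real n)\<^sup>2) * (norm s)\<^sup>2)"
    using pos unfolding p_def by (simp add: field_simps power2_eq_square)
  also have "\<dots> \<le> ?N * (p / (real b)\<^sup>2 * Q + 0)"
    using q0 qle Q0 pos
    by (intro mult_left_mono add_mono mult_right_mono divide_right_mono mult_nonpos_nonneg) auto
  also have "\<dots> = ?N * (1 / (real n * real b) * Q)"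
    unfolding p_def using pos by (simp add: power2_eq_square)
  finally show ?thesis unfolding s_def Q_def .
qed

section \<open>The weighted Cauchy--Schwarz inequality and its weights\<close>

lemma norm_add3_sq_le_weighted:
  fixes u v w :: "'a::real_normed_vector"
  assumes "0 < \<alpha>" "0 < \<beta>" "0 < \<delta>" "1 / \<alpha> + 1 / \<beta> + 1 / \<delta> \<le> 1"
  shows "(norm (u + v + w))\<^sup>2 \<le> \<alpha> * (norm u)\<^sup>2 + \<beta> * (norm v)\<^sup>2 + \<delta> * (norm w)\<^sup>2"
proof -
  let ?R = "\<alpha> * (norm u)\<^sup>2 + \<beta> * (norm v)\<^sup>2 + \<delta> * (norm w)\<^sup>2"
  have "(norm (u + v + w))\<^sup>2 \<le> (norm u + norm v + norm w)\<^sup>2"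
    by (intro power_mono norm_triangle_le add_right_mono norm_triangle_ineq) auto
  also have "\<dots> \<le> ?R * (1 / \<alpha> + 1 / \<beta> + 1 / \<delta>)"
  proof -
    (* weighted arithmetic-geometric mean inequality, for the three mixed products *)
    have two: "2 * a * c \<le> s / t * a\<^sup>2 + t / s * c\<^sup>2" if "0 < s" "0 < t" for a c s t :: real
    proof -
      have "0 \<le> (s * a - t * c)\<^sup>2 / (s * t)" using that by simp
      also have "\<dots> = s / t * a\<^sup>2 + t / s * c\<^sup>2 - 2 * a * c"
        using that by (simp add: field_simps power2_eq_square)
      finally show ?thesis by simp
    qed
    have "?R * (1 / \<alpha> + 1 / \<beta> + 1 / \<delta>) = (norm u)\<^sup>2 + (norm v)\<^sup>2 + (norm w)\<^sup>2
      + (\<alpha> / \<beta> * (norm u)\<^sup>2 + \<beta> / \<alpha> * (norm v)\<^sup>2) + (\<alpha> / \<delta> * (norm u)\<^sup>2 + \<delta> / \<alpha> * (norm w)\<^sup>2)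
      + (\<beta> / \<delta> * (norm v)\<^sup>2 + \<delta> / \<beta> * (norm w)\<^sup>2)"
      using assms(1-3) by (simp add: distrib_left distrib_right add_divide_distrib)
    then show ?thesis
      using two[of \<alpha> \<beta> "norm u" "norm v"] two[of \<alpha> \<delta> "norm u" "norm w"]
        two[of \<beta> \<delta> "norm v" "norm w"] assms(1-3)
      by (simp add: power2_sum distrib_left distrib_right)
  qed
  also have "\<dots> \<le> ?R * 1"
    using assms by (intro mult_left_mono add_nonneg_nonneg mult_nonneg_nonneg) auto
  finally show ?thesis by simp
qed

text \<open>
  The weights behind the constants: the second denominator is $bC$ and the other two are the values of
  $\alpha$ and $\delta$ forced by $\rho$ and $\hat C$.  Integrality enters through $b\ge1$ and $n-b\ge1$,
  and without the latter the inequality fails for $b=n=1$.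
\<close>

lemma young_weights_sum_le_1:
  fixes n b :: nat
  assumes "1 \<le> b" "b < n"
  shows "1 / ((2 * real n - real b) / (2 * (real n - real b)))
    + 1 / ((2 * (real n - real b) * (2 * real n + real b) + (real b)\<^sup>2) / real n)
    + 1 / (2 * (2 * real n + real b)) \<le> 1"
proof -
  define B where "B = real b"
  define D where "D = real n - real b"
  have n: "real n = B + D" and BD: "1 \<le> B" "1 \<le> D"
    using assms by (auto simp: B_def D_def)
  (* the inequality cleared of denominators, as a sum of terms nonnegative for B, D at least 1 *)
  have "0 \<le> 6 * B^3 * (B - 1) + B^3 * (10 * D - 1) + 30 * B^2 * D * (B - 1) + 8 * B^2 * D^2
      + 40 * B * D^2 * (B - 1) + 16 * D^3 * (B - 1)"
    using BD by (intro add_nonneg_nonneg mult_nonneg_nonneg) auto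
  also have "\<dots> = 2 * B * (B^2 + 6*B*D + 4*D^2) * (3*B + 2*D)
      - 2 * (B + D) * (3*B + 2*D) * (B + 2*D) - (B^2 + 6*B*D + 4*D^2) * (B + 2*D)"
    by (simp add: algebra_simps power2_eq_square power3_eq_cube)
  finally have key: "2 * (B + D) * (3*B + 2*D) * (B + 2*D) + (B^2 + 6*B*D + 4*D^2) * (B + 2*D)
      \<le> 2 * B * (B^2 + 6*B*D + 4*D^2) * (3*B + 2*D)" by simp
  define u v w where "u = B^2 + 6*B*D + 4*D^2" and "v = 3*B + 2*D" and "w = B + 2*D"
  have pos: "0 < u" "0 < v" "0 < w"
    using BD by (auto simp: u_def v_def w_def intro!: add_pos_nonneg mult_nonneg_nonneg)
  have key': "2 * (B + D) * v * w + u * w \<le> 2 * B * u * v"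
    using key by (simp add: u_def v_def w_def)
  have "(B + D) / u + 1 / (2 * v) \<le> B / w"
    using key' pos by (simp add: field_simps)
  moreover have "2 * D / w = 1 - B / w"
    using pos by (simp add: field_simps w_def)
  moreover have "2 * real n - real b = w" "real n - real b = D" "2 * real n + real b = v"
    "2 * (real n - real b) * (2 * real n + real b) + (real b)\<^sup>2 = u"
    using n
    by (simp_all add: w_def D_def[symmetric] B_def[symmetric] v_def u_def algebra_simps
        power2_eq_square)
  ultimately show ?thesis using n by simp
qed

section \<open>Residuals and increments\<close>

definition batch_error :: "nat \<Rightarrow> nat \<Rightarrow> (nat \<Rightarrow> 'v) \<Rightarrow> nat set \<Rightarrow> 'v::real_vector" where
  "batch_error n b y T = (1 / real b) *\<^sub>R (\<Sum>i\<in>T. y i) - (1 / real n) *\<^sub>R (\<Sum>i=1..n. y i)"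

lemma sum_batch_error:
  assumes "1 \<le> b" "b \<le> n"
  shows "(\<Sum>T\<in>batches n b. batch_error n b y T) = 0"
  using assms
  by (simp add: batch_error_def sum_subtractf scaleR_sum_right[symmetric] sum_over_batches
      sum_constant_scaleR)

definition saga_residual ::
    "(nat \<Rightarrow> 'v \<Rightarrow> 'v) \<Rightarrow> real \<Rightarrow> (nat \<Rightarrow> 'w \<Rightarrow> 'v) \<Rightarrow> (nat \<Rightarrow> 'w \<Rightarrow> nat set)
      \<Rightarrow> nat \<Rightarrow> nat \<Rightarrow> 'w \<Rightarrow> 'v::real_vector" where
  "saga_residual G \<gamma> x B k i \<omega> = G i (iterate x (int k) \<omega>) - \<gamma> *\<^sub>R G i (iterate x (int k - 1) \<omega>)
     - (1 - \<gamma>) *\<^sub>R saga_table G x B k i \<omega>"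

definition saga_increment ::
    "(nat \<Rightarrow> 'v \<Rightarrow> 'v) \<Rightarrow> (nat \<Rightarrow> 'w \<Rightarrow> 'v) \<Rightarrow> int \<Rightarrow> nat \<Rightarrow> 'w \<Rightarrow> 'v::real_vector" where
  "saga_increment G x k i \<omega> = G i (iterate x k \<omega>) - G i (iterate x (k - 1) \<omega>)"

lemma saga_estimator_error:
  "saga_estimator n b G \<gamma> x B k \<omega> - S_target n G \<gamma> x k \<omega>
    = batch_error n b (\<lambda>i. saga_residual G \<gamma> x B k i \<omega>) (B k \<omega>)"
proof -
  have split: "(\<Sum>i\<in>A. saga_residual G \<gamma> x B k i \<omega>)
      = (\<Sum>i\<in>A. G i (iterate x (int k) \<omega>)) - \<gamma> *\<^sub>R (\<Sum>i\<in>A. G i (iterate x (int k - 1) \<omega>))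
        - (1 - \<gamma>) *\<^sub>R (\<Sum>i\<in>A. saga_table G x B k i \<omega>)" for A
    by (simp only: saga_residual_def sum_subtractf scaleR_sum_right)
  show ?thesis
    unfolding saga_estimator_def S_target_def mean_op_def batch_error_def split
    by (simp only: scaleR_diff_right scaleR_scaleR mult.commute[of "1 / real b"]
        mult.commute[of "1 / real n"]) (simp add: algebra_simps)
qed

lemma saga_residual_0: "saga_residual G \<gamma> x B 0 i \<omega> = 0"
  by (simp add: saga_residual_def iterate_def algebra_simps)

text \<open>
  A refreshed table entry equals $G_i x^k$ and cancels all of the residual except the last increment;
  a stale one carries the old residual along.
\<close>

lemma saga_residual_Suc:
  "saga_residual G \<gamma> x B (Suc k) i \<omega> =
    (if i \<in> B k \<omega> then saga_increment G x (int (Suc k)) i \<omega>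
     else saga_residual G \<gamma> x B k i \<omega> + saga_increment G x (int (Suc k)) i \<omega>
       + (- \<gamma>) *\<^sub>R saga_increment G x (int k) i \<omega>)"
  by (simp add: saga_residual_def saga_increment_def iterate_def algebra_simps)

section \<open>Square-integrable random vectors\<close>

definition square_integrable :: "'w measure \<Rightarrow> ('w \<Rightarrow> 'v::euclidean_space) \<Rightarrow> bool" where
  "square_integrable M f \<longleftrightarrow> f \<in> borel_measurable M \<and> integrable M (\<lambda>\<omega>. (norm (f \<omega>))\<^sup>2)"

lemma square_integrable_dominated:
  fixes f :: "'w \<Rightarrow> 'v::euclidean_space"
  assumes "f \<in> borel_measurable M" "integrable M g"
    and "\<And>\<omega>. \<omega> \<in> space M \<Longrightarrow> (norm (f \<omega>))\<^sup>2 \<le> g \<omega>"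
  shows "square_integrable M f"
  unfolding square_integrable_def
proof
  show "integrable M (\<lambda>\<omega>. (norm (f \<omega>))\<^sup>2)"
  proof (rule Bochner_Integration.integrable_bound[OF assms(2)])
    show "AE \<omega> in M. norm ((norm (f \<omega>))\<^sup>2) \<le> norm (g \<omega>)"
      by (rule AE_I2) (use assms(3) in \<open>auto intro: order_trans[OF _ abs_ge_self]\<close>)
  qed (use assms(1) in measurable)
qed (rule assms(1))

lemma square_integrable_scaleR:
  assumes "square_integrable M f" shows "square_integrable M (\<lambda>\<omega>. c *\<^sub>R f \<omega>)"
  using assms by (auto simp: square_integrable_def power_mult_distrib)

lemma square_integrable_add:
  assumes "square_integrable M f" "square_integrable M g" shows "square_integrable M (\<lambda>\<omega>. f \<omega> + g \<omega>)"
proof (rule square_integrable_dominated)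
  show "(norm (f \<omega> + g \<omega>))\<^sup>2 \<le> 2 * (norm (f \<omega>))\<^sup>2 + 2 * (norm (g \<omega>))\<^sup>2" for \<omega>
  proof -
    have "(norm (f \<omega> + g \<omega>))\<^sup>2 \<le> (norm (f \<omega>) + norm (g \<omega>))\<^sup>2"
      by (intro power_mono norm_triangle_ineq) simp
    also have "\<dots> \<le> 2 * (norm (f \<omega>))\<^sup>2 + 2 * (norm (g \<omega>))\<^sup>2"
      using zero_le_power2[of "norm (f \<omega>) - norm (g \<omega>)"] by (simp add: power2_sum power2_diff)
    finally show ?thesis .
  qed
qed (use assms in \<open>auto simp: square_integrable_def\<close>)

lemma square_integrable_diff:
  assumes "square_integrable M f" "square_integrable M g" shows "square_integrable M (\<lambda>\<omega>. f \<omega> - g \<omega>)"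
  using square_integrable_add[OF assms(1) square_integrable_scaleR[OF assms(2), of "- 1"]] by simp

lemma square_integrable_sum:
  assumes "\<And>i. i \<in> I \<Longrightarrow> square_integrable M (f i)" shows "square_integrable M (\<lambda>\<omega>. \<Sum>i\<in>I. f i \<omega>)"
  using assms
proof (induction I rule: infinite_finite_induct)
  case (insert i I)
  then show ?case by (simp add: square_integrable_add)
qed (simp_all add: square_integrable_def)

lemma (in prob_space) square_integrable_integrable_inner:
  assumes "square_integrable M f" shows "integrable M (\<lambda>\<omega>. f \<omega> \<bullet> v)"
proof (rule Bochner_Integration.integrable_bound)
  show "integrable M (\<lambda>\<omega>. (norm (f \<omega>))\<^sup>2 + (norm v)\<^sup>2)"
    using assms by (simp add: square_integrable_def)
  show "AE \<omega> in M. norm (f \<omega> \<bullet> v) \<le> norm ((norm (f \<omega>))\<^sup>2 + (norm v)\<^sup>2)"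
  proof (rule AE_I2)
    fix \<omega>
    have "norm (f \<omega> \<bullet> v) \<le> norm (f \<omega>) * norm v"
      using Cauchy_Schwarz_ineq2[of "f \<omega>" v] by simp
    also have "\<dots> \<le> (norm (f \<omega>))\<^sup>2 + (norm v)\<^sup>2"
    proof -
      have "0 \<le> norm (f \<omega>) * norm v" by simp
      then show ?thesis using sum_squares_bound[of "norm (f \<omega>)" "norm v"] by linarith
    qed
    finally show "norm (f \<omega> \<bullet> v) \<le> norm ((norm (f \<omega>))\<^sup>2 + (norm v)\<^sup>2)" by simp
  qed
qed (use assms in \<open>auto simp: square_integrable_def\<close>)

section \<open>Integration over a random batch\<close>

context saga_process
begin

lemma F_measurable_mono:
  assumes "f \<in> borel_measurable (F j)" "j \<le> k" shows "f \<in> borel_measurable (F k)"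
  using measurable_from_subalg[OF _ assms(1)] sets_F_mono[OF assms(2)]
  by (simp add: subalgebra_def space_F)

lemma F_measurable_M: "f \<in> borel_measurable (F k) \<Longrightarrow> f \<in> borel_measurable M"
  using measurable_from_subalg[OF subalg] .

lemma B_measurable: "B k \<in> measurable M (count_space (batches n b))"
  using measurable_from_subalg[OF subalg B_adapted] .

lemma B_in_batches: "\<omega> \<in> space M \<Longrightarrow> B k \<omega> \<in> batches n b"
  using measurable_space[OF B_measurable] by simp

lemma card_batches_pos: "0 < card (batches n b)"
  using batch_size by (simp add: card_batches)

lemma batch_event_F:
  "{\<omega> \<in> space M. P (B k \<omega>)} \<in> sets (F (Suc k))"
proof -
  have "{\<omega> \<in> space M. P (B k \<omega>)} = B k -` {T \<in> batches n b. P T} \<inter> space (F (Suc k))"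
    using B_in_batches by (auto simp: space_F)
  also have "\<dots> \<in> sets (F (Suc k))"
    by (rule measurable_sets[OF B_adapted]) auto
  finally show ?thesis .
qed

lemma prob_batch:
  assumes "T \<in> batches n b"
  shows "prob {\<omega> \<in> space M. B k \<omega> = T} = 1 / real (card (batches n b))"
proof -
  have "measure (distr M (count_space (batches n b)) (B k)) {T} = prob (B k -` {T} \<inter> space M)"
    using assms by (intro measure_distr B_measurable) auto
  also have "B k -` {T} \<inter> space M = {\<omega> \<in> space M. B k \<omega> = T}" by auto
  finally show ?thesis
    using assms by (simp add: B_uniform measure_uniform_count_measure finite_batches)
qed

lemma integral_on_batch:
  fixes f :: "'w \<Rightarrow> real"
  assumes T: "T \<in> batches n b" and f: "f \<in> borel_measurable (F k)" "integrable M f"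
  shows "integrable M (\<lambda>\<omega>. f \<omega> * indicator {T} (B k \<omega>))"
    and "(\<integral>\<omega>. f \<omega> * indicator {T} (B k \<omega>) \<partial>M) = (\<integral>\<omega>. f \<omega> \<partial>M) / real (card (batches n b))"
proof -
  define h where "h = (\<lambda>\<omega>. indicator {T} (B k \<omega>) :: real)"
  have h_meas [measurable]: "h \<in> borel_measurable M"
    unfolding h_def
    by (rule measurable_compose[OF B_measurable, where g = "indicator {T}"])
       (rule borel_measurable_count_space)
  have h_int: "integrable M h"
    by (rule integrable_const_bound[where B = 1, OF _ h_meas]) (auto simp: h_def indicator_def)
  have "(\<integral>\<omega>. h \<omega> \<partial>M) = (\<integral>\<omega>. indicator {\<omega> \<in> space M. B k \<omega> = T} \<omega> \<partial>M)"
    by (intro Bochner_Integration.integral_cong) (auto simp: h_def indicator_def)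
  also have "\<dots> = 1 / real (card (batches n b))"
    using prob_batch[OF T] by (simp add: Int_absorb2 subset_iff)
  finally have h_mean: "(\<integral>\<omega>. h \<omega> \<partial>M) = 1 / real (card (batches n b))" .
  have "indep_var borel f borel h"
    unfolding indep_var_eq
  proof (intro conjI)
    have f_gen: "sigma_sets (space M) {f -` A \<inter> space M |A. A \<in> sets borel} \<subseteq> sets (F k)"
      using sets.sigma_sets_subset[of "{f -` A \<inter> space M |A. A \<in> sets borel}" "F k"]
        measurable_sets[OF f(1)] by (auto simp: space_F)
    let ?V = "vimage_algebra (space M) (B k) (count_space (batches n b))"
    have "h -` A \<inter> space M \<in> sets ?V" for A
    proof -
      have "h -` A \<inter> space M = B k -` {S \<in> batches n b. indicator {T} S \<in> A} \<inter> space M"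
        using B_in_batches by (auto simp: h_def)
      then show ?thesis by (simp only:) (rule in_vimage_algebra, auto)
    qed
    then have h_gen: "sigma_sets (space M) {h -` A \<inter> space M |A. A \<in> sets borel} \<subseteq> sets ?V"
      using sets.sigma_sets_subset[of "{h -` A \<inter> space M |A. A \<in> sets borel}" ?V] by auto
    show "indep_set (sigma_sets (space M) {f -` A \<inter> space M |A. A \<in> sets borel})
        (sigma_sets (space M) {h -` A \<inter> space M |A. A \<in> sets borel})"
      using B_indep[of k] unfolding indep_set_def
      by (rule indep_sets_mono_sets) (use f_gen h_gen in \<open>auto split: bool.split\<close>)
  qed (use f h_meas F_measurable_M in auto)
  from indep_var_integrable[OF this f(2) h_int] indep_var_lebesgue_integral[OF this f(2) h_int]
  show "integrable M (\<lambda>\<omega>. f \<omega> * indicator {T} (B k \<omega>))"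
    and "(\<integral>\<omega>. f \<omega> * indicator {T} (B k \<omega>) \<partial>M) = (\<integral>\<omega>. f \<omega> \<partial>M) / real (card (batches n b))"
    by (simp_all add: h_mean h_def[symmetric]) (simp_all add: h_def)
qed

text \<open>
  Since \<open>B k\<close> is uniform and independent of \<open>F k\<close>, it can be integrated out with everything
  \<open>F k\<close>-measurable held fixed.  This replaces a conditional expectation given \<open>F k\<close>.
\<close>

lemma integral_random_batch:
  fixes g :: "nat set \<Rightarrow> 'w \<Rightarrow> real"
  assumes "\<And>T. T \<in> batches n b \<Longrightarrow> g T \<in> borel_measurable (F k)"
    and "\<And>T. T \<in> batches n b \<Longrightarrow> integrable M (g T)"
  shows "integrable M (\<lambda>\<omega>. g (B k \<omega>) \<omega>)"
    and "(\<integral>\<omega>. g (B k \<omega>) \<omega> \<partial>M) = (\<integral>\<omega>. (\<Sum>T\<in>batches n b. g T \<omega>) \<partial>M) / real (card (batches n b))"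
proof -
  have split: "g (B k \<omega>) \<omega> = (\<Sum>T\<in>batches n b. g T \<omega> * indicator {T} (B k \<omega>))"
    if "\<omega> \<in> space M" for \<omega>
    using B_in_batches[OF that] finite_batches by (simp add: indicator_def if_distrib cong: if_cong)
  show "integrable M (\<lambda>\<omega>. g (B k \<omega>) \<omega>)"
    by (subst Bochner_Integration.integrable_cong[OF refl split])
       (auto intro!: integral_on_batch assms)
  have "(\<integral>\<omega>. g (B k \<omega>) \<omega> \<partial>M) = (\<integral>\<omega>. (\<Sum>T\<in>batches n b. g T \<omega> * indicator {T} (B k \<omega>)) \<partial>M)"
    by (intro Bochner_Integration.integral_cong refl split)
  also have "\<dots> = (\<Sum>T\<in>batches n b. (\<integral>\<omega>. g T \<omega> \<partial>M) / real (card (batches n b)))"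
    by (subst Bochner_Integration.integral_sum)
       (auto intro!: sum.cong integral_on_batch assms)
  finally show "(\<integral>\<omega>. g (B k \<omega>) \<omega> \<partial>M)
      = (\<integral>\<omega>. (\<Sum>T\<in>batches n b. g T \<omega>) \<partial>M) / real (card (batches n b))"
    by (simp add: sum_divide_distrib assms)
qed


text \<open>
  A quantity known before the draw meets the event $i\notin B_k$ with probability $1-b/n$.
\<close>

lemma integral_unrefreshed:
  fixes f :: "'w \<Rightarrow> real"
  assumes i: "i \<in> {1..n}" and f: "f \<in> borel_measurable (F k)" "integrable M f"
  shows "integrable M (\<lambda>\<omega>. if i \<in> B k \<omega> then 0 else f \<omega>)"
    and "(\<integral>\<omega>. (if i \<in> B k \<omega> then 0 else f \<omega>) \<partial>M) = (1 - real b / real n) * (\<integral>\<omega>. f \<omega> \<partial>M)"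
proof -
  let ?N = "real (card (batches n b))"
  have g: "(\<lambda>\<omega>. if i \<in> T then 0 else f \<omega>) \<in> borel_measurable (F k)"
    "integrable M (\<lambda>\<omega>. if i \<in> T then 0 else f \<omega>)" for T
    using f by (cases "i \<in> T"; simp)+
  show "integrable M (\<lambda>\<omega>. if i \<in> B k \<omega> then 0 else f \<omega>)"
    using integral_random_batch(1)[where g = "\<lambda>T \<omega>. if i \<in> T then 0 else f \<omega>", OF g] .
  have "(\<Sum>T\<in>batches n b. if i \<in> T then 0 else f \<omega>) = ?N * ((1 - real b / real n) * f \<omega>)" for \<omega>
  proof -
    have "(\<Sum>T\<in>batches n b. if i \<in> T then 0 else f \<omega>)
        = (\<Sum>T\<in>batches n b. f \<omega> - (if i \<in> T then f \<omega> else 0))"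
      by (intro sum.cong) auto
    also have "\<dots> = ?N * f \<omega> - real (card {T \<in> batches n b. i \<in> T}) * f \<omega>"
      by (simp add: sum_subtractf sum.inter_filter[symmetric] finite_batches)
    finally show ?thesis
      using card_batches_containing_point[OF batch_size i] by (simp add: algebra_simps)
  qed
  then show "(\<integral>\<omega>. (if i \<in> B k \<omega> then 0 else f \<omega>) \<partial>M) = (1 - real b / real n) * (\<integral>\<omega>. f \<omega> \<partial>M)"
    using integral_random_batch(2)[where g = "\<lambda>T \<omega>. if i \<in> T then 0 else f \<omega>", OF g] card_batches_pos
    by simp
qed

section \<open>Adaptedness and square integrability along the process\<close>

lemma Gx_iterate_square_integrable: "i \<in> {1..n} \<Longrightarrow> square_integrable M (\<lambda>\<omega>. G i (iterate x k \<omega>))"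
  unfolding square_integrable_def iterate_def
  using F_measurable_M[OF Gx_adapted] Gx_square_integrable by blast

lemma Gx_F: "i \<in> {1..n} \<Longrightarrow> nat j \<le> k \<Longrightarrow> (\<lambda>\<omega>. G i (iterate x j \<omega>)) \<in> borel_measurable (F k)"
  unfolding iterate_def using F_measurable_mono[OF Gx_adapted] by blast

lemma saga_table_F:
  assumes i: "i \<in> {1..n}"
  shows "saga_table G x B k i \<in> borel_measurable (F k)"
proof (induction k)
  case 0
  then show ?case using Gx_adapted[OF i, of 0] by (simp cong: measurable_cong)
next
  case (Suc k)
  have "(\<lambda>\<omega>. if i \<in> B k \<omega> then G i (x k \<omega>) else saga_table G x B k i \<omega>)
      \<in> borel_measurable (F (Suc k))"
  proof (rule measurable_If)
    show "{\<omega> \<in> space (F (Suc k)). i \<in> B k \<omega>} \<in> sets (F (Suc k))"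
      using batch_event_F[of "\<lambda>T. i \<in> T" k] by (simp add: space_F)
  qed (use F_measurable_mono[OF Gx_adapted[OF i, of k]] F_measurable_mono[OF Suc] in auto)
  then show ?case by (simp cong: measurable_cong)
qed

text \<open>
  Every table entry is one of the values $G_i x^j$ with $j\le k$, so their squares together dominate it.
\<close>

lemma saga_table_square_integrable:
  assumes i: "i \<in> {1..n}"
  shows "square_integrable M (saga_table G x B k i)"
proof (rule square_integrable_dominated)
  show "integrable M (\<lambda>\<omega>. \<Sum>j\<le>k. (norm (G i (x j \<omega>)))\<^sup>2)"
    using Gx_square_integrable[OF i] by auto
  show "(norm (saga_table G x B k i \<omega>))\<^sup>2 \<le> (\<Sum>j\<le>k. (norm (G i (x j \<omega>)))\<^sup>2)" for \<omega>
  proof (induction k)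
    case (Suc k)
    have "(norm (G i (x k \<omega>)))\<^sup>2 \<le> (\<Sum>j\<le>k. (norm (G i (x j \<omega>)))\<^sup>2)"
      by (rule member_le_sum) auto
    then show ?case using Suc by (auto intro: add_increasing2)
  qed simp
qed (rule F_measurable_M[OF saga_table_F[OF i]])

lemma saga_residual_F:
  assumes "i \<in> {1..n}" shows "saga_residual G \<gamma> x B k i \<in> borel_measurable (F k)"
  unfolding saga_residual_def
  using Gx_F[OF assms, of "int k" k] Gx_F[OF assms, of "int k - 1" k] saga_table_F[OF assms, of k]
  by auto

lemma saga_residual_square_integrable:
  assumes "i \<in> {1..n}" shows "square_integrable M (saga_residual G \<gamma> x B k i)"
  unfolding saga_residual_def
  by (intro square_integrable_diff square_integrable_scaleR Gx_iterate_square_integrable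
      saga_table_square_integrable assms)

lemma saga_increment_F:
  assumes "i \<in> {1..n}" shows "saga_increment G x (int k) i \<in> borel_measurable (F k)"
  unfolding saga_increment_def
  using Gx_F[OF assms, of "int k" k] Gx_F[OF assms, of "int k - 1" k] by auto

lemma saga_increment_square_integrable:
  assumes "i \<in> {1..n}" shows "square_integrable M (saga_increment G x k i)"
  unfolding saga_increment_def by (intro square_integrable_diff Gx_iterate_square_integrable assms)

lemma batch_error_F:
  assumes "T \<in> batches n b"
  shows "(\<lambda>\<omega>. batch_error n b (\<lambda>i. saga_residual G \<gamma> x B k i \<omega>) T) \<in> borel_measurable (F k)"
  unfolding batch_error_def
  using batchesD(1)[OF assms]
  by (intro borel_measurable_diff borel_measurable_scaleR borel_measurable_sum
      borel_measurable_const saga_residual_F) blast+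

lemma batch_error_square_integrable:
  assumes "T \<in> batches n b"
  shows "square_integrable M (\<lambda>\<omega>. batch_error n b (\<lambda>i. saga_residual G \<gamma> x B k i \<omega>) T)"
  unfolding batch_error_def
  using batchesD(1)[OF assms]
  by (intro square_integrable_diff square_integrable_scaleR square_integrable_sum
      saga_residual_square_integrable) blast+

section \<open>The first two moments of the error\<close>

text \<open>
  For an event \<open>A\<close> of the past, the integral of the error over \<open>A\<close> is an average over all batches
  of integrals of \<open>F k\<close>-measurable functions, and the errors of all batches sum to zero pointwise.
\<close>

lemma saga_unbiased:
  "AE \<omega> in M. real_cond_exp M (sigma_iterates M x k)
     (\<lambda>\<omega>. (saga_estimator n b G \<gamma> x B k \<omega> - S_target n G \<gamma> x k \<omega>) $ j) \<omega> = 0"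
proof -
  define e where "e T \<omega> = batch_error n b (\<lambda>i. saga_residual G \<gamma> x B k i \<omega>) T \<bullet> axis j 1"
    for T \<omega>
  have e_F: "e T \<in> borel_measurable (F k)" and e_int: "integrable M (e T)"
    if "T \<in> batches n b" for T
    using batch_error_F[OF that] square_integrable_integrable_inner[OF batch_error_square_integrable[OF that]]
    unfolding e_def by auto
  have sets_sub: "sets (sigma_iterates M x k) \<subseteq> sets (F k)"
  proof -
    have "x l -` A \<inter> space M \<in> sets (F k)" if "l \<le> k" "A \<in> sets borel" for l A
      using measurable_sets[OF F_measurable_mono[OF x_adapted that(1)] that(2)] by (simp add: space_F)
    then have "{x l -` A \<inter> space M | l A. l \<le> k \<and> A \<in> sets borel} \<subseteq> sets (F k)" by auto
    then have "sigma_sets (space (F k)) {x l -` A \<inter> space M | l A. l \<le> k \<and> A \<in> sets borel}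
        \<subseteq> sets (F k)"
      by (rule sets.sigma_sets_subset)
    then show ?thesis unfolding sigma_iterates_def by (subst sets_measure_of) (auto simp: space_F)
  qed
  have sub: "subalgebra M (sigma_iterates M x k)"
    using sets_sub subalg[of k] by (auto simp: subalgebra_def sigma_iterates_def space_measure_of_conv)
  interpret past: finite_measure_subalgebra M "sigma_iterates M x k"
    by unfold_locales (rule sub)
  have "AE \<omega> in M. real_cond_exp M (sigma_iterates M x k) (\<lambda>\<omega>. e (B k \<omega>) \<omega>) \<omega> = 0"
  proof (rule past.real_cond_exp_charact)
    fix A assume "A \<in> sets (sigma_iterates M x k)"
    then have A: "A \<in> sets (F k)" "A \<in> sets M" using sets_sub subalg[of k] by (auto simp: subalgebra_def)
    have ind_F: "(\<lambda>\<omega>. indicator A \<omega> * e T \<omega>) \<in> borel_measurable (F k)"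
      and ind_int: "integrable M (\<lambda>\<omega>. indicator A \<omega> * e T \<omega>)" if "T \<in> batches n b" for T
      using e_F[OF that] A(1) integrable_mult_indicator[OF A(2) e_int[OF that]] by auto
    have "(LINT \<omega>:A|M. e (B k \<omega>) \<omega>)
        = (\<integral>\<omega>. (\<Sum>T\<in>batches n b. indicator A \<omega> * e T \<omega>) \<partial>M) / real (card (batches n b))"
      using integral_random_batch(2)[where g = "\<lambda>T \<omega>. indicator A \<omega> * e T \<omega>", OF ind_F ind_int]
      by (simp add: set_lebesgue_integral_def)
    moreover have "(\<Sum>T\<in>batches n b. indicator A \<omega> * e T \<omega>) = 0" for \<omega>
      unfolding e_def sum_distrib_left[symmetric] inner_sum_left[symmetric]
      by (simp add: sum_batch_error[OF batch_size])
    ultimately show "(LINT \<omega>:A|M. e (B k \<omega>) \<omega>) = (LINT \<omega>:A|M. 0)" by simp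
  next
    show "integrable M (\<lambda>\<omega>. e (B k \<omega>) \<omega>)"
      by (rule integral_random_batch(1)[where g = e, OF e_F e_int])
  qed auto
  then show ?thesis by (simp add: saga_estimator_error e_def inner_axis)
qed

lemma saga_second_moment:
  shows "integrable M (\<lambda>\<omega>. (norm (saga_estimator n b G \<gamma> x B k \<omega> - S_target n G \<gamma> x k \<omega>))\<^sup>2)" (is ?int)
    and "(\<integral>\<omega>. (norm (saga_estimator n b G \<gamma> x B k \<omega> - S_target n G \<gamma> x k \<omega>))\<^sup>2 \<partial>M)
      \<le> 1 / (real n * real b) * (\<Sum>i=1..n. \<integral>\<omega>. (norm (saga_residual G \<gamma> x B k i \<omega>))\<^sup>2 \<partial>M)" (is ?le)
proof -
  let ?N = "real (card (batches n b))"
  define g where "g T \<omega> = (norm (batch_error n b (\<lambda>i. saga_residual G \<gamma> x B k i \<omega>) T))\<^sup>2" for T \<omega>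
  have g_F: "g T \<in> borel_measurable (F k)" and g_int: "integrable M (g T)"
    if "T \<in> batches n b" for T
    using batch_error_F[OF that] batch_error_square_integrable[OF that]
    unfolding g_def square_integrable_def by auto
  show ?int
    using integral_random_batch(1)[where g = g, OF g_F g_int] by (simp add: saga_estimator_error g_def)
  have res_int: "integrable M (\<lambda>\<omega>. (norm (saga_residual G \<gamma> x B k i \<omega>))\<^sup>2)" if "i \<in> {1..n}" for i
    using saga_residual_square_integrable[OF that] by (simp add: square_integrable_def)
  have "(\<integral>\<omega>. (\<Sum>T\<in>batches n b. g T \<omega>) \<partial>M)
      \<le> (\<integral>\<omega>. ?N * (1 / (real n * real b) * (\<Sum>i=1..n. (norm (saga_residual G \<gamma> x B k i \<omega>))\<^sup>2)) \<partial>M)"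
  proof (rule integral_mono)
    fix \<omega>
    show "(\<Sum>T\<in>batches n b. g T \<omega>)
        \<le> ?N * (1 / (real n * real b) * (\<Sum>i=1..n. (norm (saga_residual G \<gamma> x B k i \<omega>))\<^sup>2))"
      unfolding g_def batch_error_def by (rule batch_mean_deviation[OF batch_size])
  next
    show "integrable M (\<lambda>\<omega>. ?N * (1 / (real n * real b)
        * (\<Sum>i=1..n. (norm (saga_residual G \<gamma> x B k i \<omega>))\<^sup>2)))"
      by (intro integrable_mult_right Bochner_Integration.integrable_sum res_int)
  qed (use g_int in auto)
  also have "\<dots> = ?N * (1 / (real n * real b)
      * (\<Sum>i=1..n. \<integral>\<omega>. (norm (saga_residual G \<gamma> x B k i \<omega>))\<^sup>2 \<partial>M))"
    using res_int by simp
  finally show ?le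
    using integral_random_batch(2)[where g = g, OF g_F g_int] card_batches_pos
    by (simp add: saga_estimator_error g_def divide_le_eq mult.commute)
qed

section \<open>The recursion for the second moments\<close>

text \<open>
  On the event $i\in B_k$ the weight \<open>\<beta>\<close> only has to be at least \<open>1\<close>; off it, the three-weight
  inequality applies.  Thus \<open>\<beta>\<close> bounds the new increment on the whole space, with no information on
  how that increment depends on \<open>B k\<close>, and everything else is \<open>F k\<close>-measurable.
\<close>

lemma residual_recursion:
  assumes i: "i \<in> {1..n}"
  shows "(\<integral>\<omega>. (norm (saga_residual G \<gamma> x B (Suc k) i \<omega>))\<^sup>2 \<partial>M)
    \<le> (1 - real b / (2 * real n)) * (\<integral>\<omega>. (norm (saga_residual G \<gamma> x B k i \<omega>))\<^sup>2 \<partial>M)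
      + (2 * (real n - real b) * (2 * real n + real b) + (real b)\<^sup>2) / real n
        * (\<integral>\<omega>. (norm (saga_increment G x (int (Suc k)) i \<omega>))\<^sup>2 \<partial>M)
      + 2 * (real n - real b) * (2 * real n + real b) * \<gamma>\<^sup>2 / real n
        * (\<integral>\<omega>. (norm (saga_increment G x (int k) i \<omega>))\<^sup>2 \<partial>M)"
proof -
  define \<alpha> where "\<alpha> = (2 * real n - real b) / (2 * (real n - real b))"
  define \<beta> where "\<beta> = (2 * (real n - real b) * (2 * real n + real b) + (real b)\<^sup>2) / real n"
  define \<delta> where "\<delta> = 2 * (2 * real n + real b)"
  let ?Y = "\<lambda>\<omega>. (norm (saga_residual G \<gamma> x B k i \<omega>))\<^sup>2"
  let ?D = "\<lambda>\<omega>. (norm (saga_increment G x (int (Suc k)) i \<omega>))\<^sup>2"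
  let ?D' = "\<lambda>\<omega>. (norm (saga_increment G x (int k) i \<omega>))\<^sup>2"
  define f where "f \<omega> = \<alpha> * ?Y \<omega> + \<delta> * \<gamma>\<^sup>2 * ?D' \<omega>" for \<omega>
  have n: "0 < real n" "1 \<le> real b" "real b \<le> real n" using batch_size by auto
  have int: "integrable M ?Y" "integrable M ?D" "integrable M ?D'"
    using saga_residual_square_integrable[OF i] saga_increment_square_integrable[OF i]
    by (auto simp: square_integrable_def)
  have f_F: "f \<in> borel_measurable (F k)"
    unfolding f_def using saga_residual_F[OF i, of \<gamma> k] saga_increment_F[OF i, of k] by auto
  have f_int: "integrable M f" unfolding f_def using int by auto
  have \<beta>1: "1 \<le> \<beta>"
  proof -
    have "real n \<le> 2 * (real n - real b) * (2 * real n + real b) + (real b)\<^sup>2"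
    proof -
      have "0 \<le> (real n - real b) * (4 * real n + 2 * real b - 1)" "real b \<le> (real b)\<^sup>2"
        using n by (auto simp: power2_eq_square)
      then show ?thesis by (simp add: algebra_simps power2_eq_square)
    qed
    then show ?thesis using n by (simp add: \<beta>_def)
  qed
  have bound: "(norm (saga_residual G \<gamma> x B (Suc k) i \<omega>))\<^sup>2
      \<le> \<beta> * ?D \<omega> + (if i \<in> B k \<omega> then 0 else f \<omega>)" if "\<omega> \<in> space M" for \<omega>
  proof (cases "i \<in> B k \<omega>")
    case True
    then show ?thesis
      using mult_right_mono[OF \<beta>1, of "?D \<omega>"] by (simp add: saga_residual_Suc)
  next
    case False
    (* some index was left out of the batch *)
    have "b < n"
    proof -
      have "B k \<omega> \<subset> {1..n}" "card (B k \<omega>) = b"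
        using batchesD[OF B_in_batches[OF that, of k]] False i by auto
      then show ?thesis using psubset_card_mono[of "{1..n}" "B k \<omega>"] by simp
    qed
    then have "0 < \<alpha>" "0 < \<beta>" "0 < \<delta>" "1 / \<alpha> + 1 / \<beta> + 1 / \<delta> \<le> 1"
      using young_weights_sum_le_1[OF batch_size(1)] \<beta>1 n by (auto simp: \<alpha>_def \<beta>_def \<delta>_def)
    from norm_add3_sq_le_weighted[OF this, of "saga_residual G \<gamma> x B k i \<omega>"
        "saga_increment G x (int (Suc k)) i \<omega>" "(- \<gamma>) *\<^sub>R saga_increment G x (int k) i \<omega>"]
    show ?thesis
      using False unfolding saga_residual_Suc f_def
      by (simp add: power_mult_distrib)
  qed
  have "(\<integral>\<omega>. (norm (saga_residual G \<gamma> x B (Suc k) i \<omega>))\<^sup>2 \<partial>M)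
      \<le> (\<integral>\<omega>. \<beta> * ?D \<omega> + (if i \<in> B k \<omega> then 0 else f \<omega>) \<partial>M)"
    using saga_residual_square_integrable[OF i, of \<gamma> "Suc k"] int integral_unrefreshed(1)[OF i f_F f_int]
    by (intro integral_mono bound) (auto simp: square_integrable_def)
  also have "\<dots> = \<beta> * (\<integral>\<omega>. ?D \<omega> \<partial>M)
      + (1 - real b / real n) * (\<alpha> * (\<integral>\<omega>. ?Y \<omega> \<partial>M) + \<delta> * \<gamma>\<^sup>2 * (\<integral>\<omega>. ?D' \<omega> \<partial>M))"
  proof -
    have "(\<integral>\<omega>. f \<omega> \<partial>M) = \<alpha> * (\<integral>\<omega>. ?Y \<omega> \<partial>M) + \<delta> * \<gamma>\<^sup>2 * (\<integral>\<omega>. ?D' \<omega> \<partial>M)"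
      unfolding f_def using int by simp
    then show ?thesis
      using int integral_unrefreshed[OF i f_F f_int] by simp
  qed
  also have "\<dots> = \<beta> * (\<integral>\<omega>. ?D \<omega> \<partial>M) + (1 - real b / real n) * \<alpha> * (\<integral>\<omega>. ?Y \<omega> \<partial>M)
      + 2 * (real n - real b) * (2 * real n + real b) * \<gamma>\<^sup>2 / real n * (\<integral>\<omega>. ?D' \<omega> \<partial>M)"
    using n by (simp add: \<delta>_def field_simps)
  also have "(1 - real b / real n) * \<alpha> * (\<integral>\<omega>. ?Y \<omega> \<partial>M)
      \<le> (1 - real b / (2 * real n)) * (\<integral>\<omega>. ?Y \<omega> \<partial>M)"
  proof (rule mult_right_mono)
    (* equality for b < n; for b = n the left-hand side is 0 *)
    show "(1 - real b / real n) * \<alpha> \<le> 1 - real b / (2 * real n)"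
    proof (cases "b = n")
      case False
      then have "0 < real n - real b" using n by simp
      then show ?thesis using n unfolding \<alpha>_def by (simp add: field_simps)
    qed (use n in simp)
  qed (simp add: integral_nonneg_AE)
  finally show ?thesis unfolding \<beta>_def by simp
qed

lemma saga_Delta_eq:
  "saga_Delta M n b G \<gamma> x B (int k)
    = 1 / (real n * real b) * (\<Sum>i=1..n. \<integral>\<omega>. (norm (saga_residual G \<gamma> x B k i \<omega>))\<^sup>2 \<partial>M)"
  by (simp add: saga_Delta_def saga_residual_def)

lemma U_seq_eq:
  "U_seq M n G x k = (1 / real n) * (\<Sum>i=1..n. \<integral>\<omega>. (norm (saga_increment G x k i \<omega>))\<^sup>2 \<partial>M)"
  by (simp add: U_seq_def saga_increment_def)

lemma saga_Delta_recursion: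
  "saga_Delta M n b G \<gamma> x B (int k)
    \<le> (1 - real b / (2 * real n)) * saga_Delta M n b G \<gamma> x B (int k - 1)
      + (2 * (real n - real b) * (2 * real n + real b) + (real b)\<^sup>2) / (real n * real b)
        * U_seq M n G x (int k)
      + 2 * (real n - real b) * (2 * real n + real b) * \<gamma>\<^sup>2 / (real n * real b)
        * U_seq M n G x (int k - 1)"
proof (cases k)
  case 0
  (* x^{-2} = x^{-1} = x^0 and the table starts with the values G_i x^0, so everything vanishes *)
  have "saga_Delta M n b G \<gamma> x B (int k) = 0"
    unfolding saga_Delta_eq 0 by (simp add: saga_residual_0)
  moreover have "saga_Delta M n b G \<gamma> x B (int k - 1) = 0"
    using 0 by (simp add: saga_Delta_def)
  moreover have "U_seq M n G x (int k) = 0" "U_seq M n G x (int k - 1) = 0"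
    using 0 by (simp_all add: U_seq_def iterate_def)
  ultimately show ?thesis by simp
next
  case (Suc m)
  define Y D where "Y l i = (\<integral>\<omega>. (norm (saga_residual G \<gamma> x B l i \<omega>))\<^sup>2 \<partial>M)"
    and "D l i = (\<integral>\<omega>. (norm (saga_increment G x (int l) i \<omega>))\<^sup>2 \<partial>M)" for l i
  define r K K' where "r = 1 - real b / (2 * real n)"
    and "K = 2 * (real n - real b) * (2 * real n + real b) + (real b)\<^sup>2"
    and "K' = 2 * (real n - real b) * (2 * real n + real b) * \<gamma>\<^sup>2"
  have n: "0 < real n" "0 < real b" using batch_size by auto
  have "1 / (real n * real b) * (\<Sum>i=1..n. Y (Suc m) i)
      \<le> 1 / (real n * real b) * (\<Sum>i=1..n. r * Y m i + K / real n * D (Suc m) i + K' / real n * D m i)"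
    unfolding Y_def D_def r_def K_def K'_def
    by (intro mult_left_mono sum_mono residual_recursion) auto
  also have "\<dots> = r * (1 / (real n * real b) * (\<Sum>i=1..n. Y m i))
      + K / (real n * real b) * (1 / real n * (\<Sum>i=1..n. D (Suc m) i))
      + K' / (real n * real b) * (1 / real n * (\<Sum>i=1..n. D m i))"
    by (simp add: sum.distrib sum_distrib_left[symmetric] sum_divide_distrib[symmetric] distrib_left)
  finally show ?thesis
    using Suc unfolding Suc saga_Delta_eq U_seq_eq Y_def D_def r_def K_def K'_def
    by (simp add: saga_Delta_eq U_seq_eq)
qed

end

theorem lemma2p3:
  fixes M :: "'w measure" and F :: "nat \<Rightarrow> 'w measure"
    and n b :: nat and \<gamma> :: real
    and G :: "nat \<Rightarrow> real ^ 'p \<Rightarrow> real ^ 'p"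
    and x0 :: "real ^ 'p"
    and x :: "nat \<Rightarrow> 'w \<Rightarrow> real ^ 'p"
    and B :: "nat \<Rightarrow> 'w \<Rightarrow> nat set"
  assumes "saga_process M F n b G x0 x B"
    and "0 \<le> \<gamma>" "\<gamma> \<le> 1"
  shows "unbiased_vr_estimator M n G x (S_target n G \<gamma> x) (saga_estimator n b G \<gamma> x B)
    (saga_Delta M n b G \<gamma> x B)
    (real b / (2 * real n))
    ((2 * (real n - real b) * (2 * real n + real b) + (real b)\<^sup>2) / (real n * real b))
    (2 * (real n - real b) * (2 * real n + real b) * \<gamma>\<^sup>2 / (real n * real b))"
proof -
  interpret saga_process M F n b G x0 x B by (rule assms(1))
  have "real b / (2 * real n) \<in> {0<..1}"
    using batch_size by simp
  then show ?thesis
    unfolding unbiased_vr_estimator_def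
    using saga_unbiased saga_second_moment saga_Delta_recursion unfolding saga_Delta_eq by blast
qed

end
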